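(* There exist a constant $c>0$, an integer $m_0$ and a polynomially bounded function $k=k(m)$ such that for every $m\ge m_0$ the following holds. Let $\mathcal V$ be the set of all valuations $v:2^{[m]}\to\mathbb R$ of precision $k(m)$ that are XOS or single-minded. Then every deterministic truthful auction rule $\mathcal A:\mathcal V^2\to\Sigma\times\mathbb R^2$ for two bidders that guarantees a $\left(\frac{\sqrt5-1}{2}+3m^{-1/3}\right)$-approximation to the optimal social welfare has communication complexity $$\mathrm{cc}(\mathcal A)\ \ge\ \exp\!\left(c\, m^{1/3}\right).$$
   Context: There are $m$ items $[m]=\{1,\dots,m\}$ and $n$ bidders (here $n=2$). A valuation is a function $v:2^{[m]}\to\mathbb R$ that is monotone ($v(S)\le v(T)$ for $S\subseteq T$) and normalized ($v(\emptyset)=0$). It has precision $k$ if all its values lie in $\{0\}\cup\{x/2^k : x\in\{1,\dots,2^{2k}\}\}$. It is XOS if there is a (nonempty, finite) collection of additive clauses $\mathcal C\subseteq\mathbb R^m$ such that $v(S)=\max_{c\in\mathcal C}\sum_{i\in S}c_i$ for all $S\subseteq[m]$. It is single-minded if there are $w\ge 0$ and $T\subseteq[m]$ with $v(S)=w$ when $S\supseteq T$ and $v(S)=0$ otherwise. $\Sigma$ is the set of allocations, i.e. tuples $(A_1,\dots,A_n)$ of pairwise disjoint subsets of $[m]$. An auction rule on $\mathcal V^n$ is a function $\mathcal A=(f,p_1,\dots,p_n):\mathcal V^n\to\Sigma\times\mathbb R^n$; $f_i$ is the bundle of bidder $i$ and $p_i$ her payment. It is truthful if for every $i$, all $v_i,v_i'\in\mathcal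 V$ and all $v_{-i}$: $v_i(f_i(v_i,v_{-i}))-p_i(v_i,v_{-i})\ge v_i(f_i(v_i',v_{-i}))-p_i(v_i',v_{-i})$. It guarantees an $\alpha$-approximation if for every profile $\sum_i v_i(f_i(v_1,\dots,v_n))\ge\alpha\cdot\max_{(S_1,\dots,S_n)\in\Sigma}\sum_i v_i(S_i)$. Communication is in the $n$-player deterministic number-in-hand blackboard model: player $i$ knows only $v_i$, all messages are visible to all players, and the transcript determines the output. The cost of a protocol is the maximum number of bits written; $\mathrm{cc}(\mathcal A)$ is the minimum cost of a protocol that computes $\mathcal A$ (both the allocation and the payments). *)

theory Defs
  imports
    Complex_Main
    "HOL-Library.FuncSet"
    "HOL-Library.Disjoint_Sets"
    "HOL-Library.Numeral_Type"
    "HOL-Library.Extended_Real"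
    "HOL-Library.Landau_Symbols"
begin

section \<open>Valuations\<close>

type_synonym item_bundle = "nat set"
type_synonym valuation = "item_bundle \<Rightarrow> real"

definition items :: "nat \<Rightarrow> nat set" where
  "items m = {1..m}"

text \<open>A valuation only has values on subsets of the item set. The \<^const>\<open>extensional\<close> condition
  makes these HOL functions correspond one-to-one to functions on the power set of \<open>[m]\<close>, so that a
  bidder's input carries nothing beyond her values.\<close>

definition valuations :: "nat \<Rightarrow> valuation set" where
  "valuations m = {v \<in> extensional (Pow (items m)). mono_on (Pow (items m)) v \<and> v {} = 0}"

definition has_precision :: "nat \<Rightarrow> nat \<Rightarrow> valuation \<Rightarrow> bool" where
  "has_precision m k v \<longleftrightarrow>
     (\<forall>S\<subseteq>items m. v S \<in> {0} \<union> {real x / 2 ^ k | x. x \<in> {1..2 ^ (2 * k)}})"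

text \<open>A clause is a vector indexed by the items; its values at other indices are irrelevant.\<close>

definition XOS :: "nat \<Rightarrow> valuation \<Rightarrow> bool" where
  "XOS m v \<longleftrightarrow>
     (\<exists>C :: (nat \<Rightarrow> real) set. finite C \<and> C \<noteq> {} \<and>
        (\<forall>S\<subseteq>items m. v S = Max ((\<lambda>c. \<Sum>i\<in>S. c i) ` C)))"

definition single_minded :: "nat \<Rightarrow> valuation \<Rightarrow> bool" where
  "single_minded m v \<longleftrightarrow>
     (\<exists>w\<ge>0. \<exists>T\<subseteq>items m. \<forall>S\<subseteq>items m. v S = (if T \<subseteq> S then w else 0))"

definition XOS_or_single_minded :: "nat \<Rightarrow> nat \<Rightarrow> valuation set" where
  "XOS_or_single_minded m k =
     {v \<in> valuations m. has_precision m k v \<and> (XOS m v \<or> single_minded m v)}"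

section \<open>Auction rules\<close>

text \<open>The bidders are the elements of a finite type \<^typ>\<open>'n\<close>.\<close>

type_synonym 'n profile = "'n \<Rightarrow> valuation"
type_synonym 'n allocation = "'n \<Rightarrow> item_bundle"
type_synonym 'n outcome = "'n allocation \<times> ('n \<Rightarrow> real)"
type_synonym 'n rule = "'n profile \<Rightarrow> 'n outcome"

definition profiles :: "valuation set \<Rightarrow> 'n profile set" where
  "profiles V = {v. \<forall>i. v i \<in> V}"

text \<open>Some items may stay unallocated.\<close>

definition allocations :: "nat \<Rightarrow> 'n allocation set" where
  "allocations m = {S. (\<forall>i. S i \<subseteq> items m) \<and> disjoint_family S}"

definition auction_rule :: "nat \<Rightarrow> valuation set \<Rightarrow> 'n rule \<Rightarrow> bool" where
  "auction_rule m V \<A> \<longleftrightarrow> \<A> \<in> profiles V \<rightarrow> allocations m \<times> UNIV"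

definition bundle_of :: "'n rule \<Rightarrow> 'n \<Rightarrow> 'n profile \<Rightarrow> item_bundle" where
  "bundle_of \<A> i v = fst (\<A> v) i"

definition payment_of :: "'n rule \<Rightarrow> 'n \<Rightarrow> 'n profile \<Rightarrow> real" where
  "payment_of \<A> i v = snd (\<A> v) i"

definition truthful :: "valuation set \<Rightarrow> 'n rule \<Rightarrow> bool" where
  "truthful V \<A> \<longleftrightarrow>
     (\<forall>v\<in>profiles V. \<forall>i. \<forall>v'\<in>V.
        v i (bundle_of \<A> i v) - payment_of \<A> i v
        \<ge> v i (bundle_of \<A> i (v(i := v'))) - payment_of \<A> i (v(i := v')))"

definition welfare :: "'n::finite profile \<Rightarrow> 'n allocation \<Rightarrow> real" where
  "welfare v S = (\<Sum>i\<in>UNIV. v i (S i))"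

definition guarantees_approximation ::
    "nat \<Rightarrow> valuation set \<Rightarrow> real \<Rightarrow> 'n::finite rule \<Rightarrow> bool" where
  "guarantees_approximation m V \<alpha> \<A> \<longleftrightarrow>
     (\<forall>v\<in>profiles V. welfare v (fst (\<A> v)) \<ge> \<alpha> * Max (welfare v ` allocations m))"

section \<open>Communication complexity\<close>

text \<open>A deterministic number-in-hand blackboard protocol is a binary tree. The current node is
  determined by the bits written so far; it names the bidder who writes the next bit, which is a
  function of her own valuation only. Leaves carry the outcome, so the transcript determines it.\<close>

datatype 'n protocol =
    Output "'n outcome"
  | Speak 'n "valuation \<Rightarrow> bool" "'n protocol" "'n protocol"

primrec run :: "'n protocol \<Rightarrow> 'n profile \<Rightarrow> 'n outcome" where
  "run (Output r) v = r"
| "run (Speak i b P Q) v = (if b (v i) then run P v else run Q v)"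

primrec bits_written :: "'n protocol \<Rightarrow> 'n profile \<Rightarrow> nat" where
  "bits_written (Output r) v = 0"
| "bits_written (Speak i b P Q) v = Suc (if b (v i) then bits_written P v else bits_written Q v)"

definition computes :: "valuation set \<Rightarrow> 'n protocol \<Rightarrow> 'n rule \<Rightarrow> bool" where
  "computes V P \<A> \<longleftrightarrow> (\<forall>v\<in>profiles V. run P v = \<A> v)"

text \<open>The maximum exists for nonempty \<open>V\<close>, even if \<open>V\<close> is infinite, since protocols have finite
  depth.\<close>

definition protocol_cost :: "valuation set \<Rightarrow> 'n protocol \<Rightarrow> nat" where
  "protocol_cost V P = Max (bits_written P ` profiles V)"

text \<open>The value is \<open>\<infinity>\<close> if no protocol computes the rule, which cannot happen for finite \<open>V\<close>.\<close>

definition cc :: "valuation set \<Rightarrow> 'n rule \<Rightarrow> enat" where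
  "cc V \<A> = (INF P\<in>{P. computes V P \<A>}. enat (protocol_cost V P))"

end

theory Submission imports Defs begin

text \<open>Write \<open>\<phi> = (sqrt 5 - 1) / 2\<close>. Fix the valuation \<open>v\<close> of bidder 1; it presents a price menu to bidder 2.
  Testing the rule against single-minded bidders for the complement of \<open>X\<close> shows that an approximation
  ratio above \<open>\<phi>\<close> forces this complement to be cheap if \<open>v X\<close> is close to \<open>v\<close> of all items and expensive
  if \<open>v X\<close> is close to \<open>0\<close>. Take exponentially many sets whose pairwise intersections are a fraction of
  order \<open>m powr (- 1 / 3)\<close> of their size, let bidder 1 be XOS with the indicators of a subfamily \<open>I\<close> as
  clauses, and let bidder 2 be XOS with the indicators of the complements of a subfamily \<open>J\<close> as clauses,
  scaled up so that she buys a cheapest of these complements. Her payment then reveals whether \<open>I\<close> and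
  \<open>J\<close> are disjoint, so the fooling set for disjointness applies.\<close>

section \<open>Set families with small pairwise intersections\<close>

lemma card_supersets:
  assumes "finite M" "Z \<subseteq> M" "card Z \<le> a"
  shows "card {Y. Z \<subseteq> Y \<and> Y \<subseteq> M \<and> card Y = a} = (card M - card Z) choose (a - card Z)"
proof -
  have fZ: "finite Z" using assms finite_subset by blast
  have "bij_betw (\<lambda>Y. Y - Z) {Y. Z \<subseteq> Y \<and> Y \<subseteq> M \<and> card Y = a}
          {Y. Y \<subseteq> M - Z \<and> card Y = a - card Z}"
  proof (rule bij_betw_byWitness[where f' = "\<lambda>Y. Y \<union> Z"])
    show "(\<lambda>Y. Y - Z) ` {Y. Z \<subseteq> Y \<and> Y \<subseteq> M \<and> card Y = a} \<subseteq> {Y. Y \<subseteq> M - Z \<and> card Y = a - card Z}"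
      using fZ by (auto simp: card_Diff_subset)
    show "(\<lambda>Y. Y \<union> Z) ` {Y. Y \<subseteq> M - Z \<and> card Y = a - card Z} \<subseteq> {Y. Z \<subseteq> Y \<and> Y \<subseteq> M \<and> card Y = a}"
    proof clarify
      fix Y assume Y: "Y \<subseteq> M - Z" "card Y = a - card Z"
      have "finite Y" using Y assms finite_subset by blast
      then have "card (Y \<union> Z) = card Y + card Z"
        using Y fZ by (intro card_Un_disjoint) auto
      then show "Z \<subseteq> Y \<union> Z \<and> Y \<union> Z \<subseteq> M \<and> card (Y \<union> Z) = a"
        using Y assms by auto
    qed
  qed auto
  then have "card {Y. Z \<subseteq> Y \<and> Y \<subseteq> M \<and> card Y = a} = card {Y. Y \<subseteq> M - Z \<and> card Y = a - card Z}"
    by (rule bij_betw_same_card)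
  also have "\<dots> = card (M - Z) choose (a - card Z)"
    using assms by (intro n_subsets) auto
  also have "card (M - Z) = card M - card Z"
    using fZ assms by (intro card_Diff_subset)
  finally show ?thesis .
qed

text \<open>A union bound: each such \<open>Y\<close> contains some \<open>t\<close>-subset
  \<open>Z\<close> of \<open>X\<close>, and all these \<open>Z\<close> have equally many supersets
  of size \<open>a\<close> in \<open>M\<close>.\<close>

lemma card_large_intersection_le:
  assumes "finite M" "X \<subseteq> M" "card X = a" "t \<le> a"
  shows "card {Y. Y \<subseteq> M \<and> card Y = a \<and> t \<le> card (X \<inter> Y)}
           \<le> (a choose t) * ((card M - t) choose (a - t))"
proof -
  have fX: "finite X" using assms finite_subset by blast
  let ?S = "\<lambda>Z. {Y. Z \<subseteq> Y \<and> Y \<subseteq> M \<and> card Y = a}"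
  let ?T = "{Z. Z \<subseteq> X \<and> card Z = t}"
  have sub: "{Y. Y \<subseteq> M \<and> card Y = a \<and> t \<le> card (X \<inter> Y)} \<subseteq> (\<Union>Z\<in>?T. ?S Z)"
  proof clarify
    fix Y assume Y: "Y \<subseteq> M" "t \<le> card (X \<inter> Y)" "a = card Y"
    obtain Z where "Z \<subseteq> X \<inter> Y" "card Z = t"
      using Y(2) by (meson obtain_subset_with_card_n)
    then show "Y \<in> (\<Union>Z\<in>?T. {Y'. Z \<subseteq> Y' \<and> Y' \<subseteq> M \<and> card Y' = card Y})"
      using Y by blast
  qed
  have fT: "finite ?T" using fX by simp
  have "finite (\<Union>Z\<in>?T. ?S Z)"
    by (rule finite_subset[of _ "Pow M"]) (use assms in auto)
  then have "card {Y. Y \<subseteq> M \<and> card Y = a \<and> t \<le> card (X \<inter> Y)} \<le> card (\<Union>Z\<in>?T. ?S Z)"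
    using sub by (rule card_mono)
  also have "\<dots> \<le> (\<Sum>Z\<in>?T. card (?S Z))"
    using fT by (rule card_UN_le)
  also have "\<dots> = (\<Sum>Z\<in>?T. (card M - t) choose (a - t))"
  proof (rule sum.cong[OF refl])
    fix Z assume "Z \<in> ?T"
    then have "Z \<subseteq> M" "card Z = t" using assms by auto
    then show "card (?S Z) = (card M - t) choose (a - t)"
      using card_supersets[of M Z a] assms by simp
  qed
  also have "\<dots> = (a choose t) * ((card M - t) choose (a - t))"
    using n_subsets[OF fX, of t] assms by simp
  finally show ?thesis .
qed

text \<open>The Gilbert--Varshamov argument: an inclusion-maximal family already is this large.\<close>

lemma ex_family_small_intersections:
  assumes "finite M" "t \<le> a" "a \<le> card M"
  obtains \<F> where "finite \<F>" "\<And>X. X \<in> \<F> \<Longrightarrow> X \<subseteq> M \<and> card X = a"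
    "\<And>X Y. X \<in> \<F> \<Longrightarrow> Y \<in> \<F> \<Longrightarrow> X \<noteq> Y \<Longrightarrow> card (X \<inter> Y) < t"
    "card M choose t \<le> card \<F> * (a choose t) ^ 2"
proof -
  let ?A = "{X. X \<subseteq> M \<and> card X = a}"
  let ?C = "{\<F>. \<F> \<subseteq> ?A \<and> (\<forall>X\<in>\<F>. \<forall>Y\<in>\<F>. X \<noteq> Y \<longrightarrow> card (X \<inter> Y) < t)}"
  have fA: "finite ?A" using assms(1) by simp
  have "finite ?C" by (rule finite_subset[of _ "Pow ?A"]) (use fA in auto)
  moreover have "?C \<noteq> {}" by blast
  ultimately have "\<exists>\<F>\<in>?C. \<forall>\<G>\<in>?C. \<F> \<subseteq> \<G> \<longrightarrow> \<F> = \<G>"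
    by (rule finite_has_maximal)
  then obtain \<F> where F: "\<F> \<in> ?C" and max: "\<forall>\<G>\<in>?C. \<F> \<subseteq> \<G> \<longrightarrow> \<F> = \<G>"
    by (rule bexE)
  have sub: "\<F> \<subseteq> ?A" and inter: "\<And>X Y. X \<in> \<F> \<Longrightarrow> Y \<in> \<F> \<Longrightarrow> X \<noteq> Y \<Longrightarrow> card (X \<inter> Y) < t"
    using F by simp_all
  have fF: "finite \<F>" using sub fA by (rule finite_subset)
  let ?N = "\<lambda>X. {Y. Y \<subseteq> M \<and> card Y = a \<and> t \<le> card (X \<inter> Y)}"
  \<comment> \<open>A set \<open>Y\<close> outside all the \<open>?N X\<close> could be inserted
    into the maximal \<open>\<F>\<close>, hence would be a member already; but it meets itself in
    \<open>a \<ge> t\<close> elements.\<close>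
  have cover: "?A \<subseteq> (\<Union>X\<in>\<F>. ?N X)"
  proof (rule ccontr)
    assume "\<not> ?A \<subseteq> (\<Union>X\<in>\<F>. ?N X)"
    then obtain Y where Y: "Y \<subseteq> M" "card Y = a" "\<And>X. X \<in> \<F> \<Longrightarrow> card (X \<inter> Y) < t"
      by (auto simp flip: not_le)
    then have "insert Y \<F> \<in> ?C"
      using sub inter by (auto simp: Int_commute)
    then have "\<F> \<subseteq> insert Y \<F> \<longrightarrow> \<F> = insert Y \<F>" by (rule bspec[OF max])
    then have "Y \<in> \<F>" by blast
    then show False using Y(3)[of Y] Y(2) assms(2) by simp
  qed
  have "card M choose a = card ?A" using n_subsets[OF assms(1), of a] by simp
  also have "\<dots> \<le> card (\<Union>X\<in>\<F>. ?N X)"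
    by (rule card_mono[OF _ cover]) (rule finite_subset[of _ "Pow M"], use assms in auto)
  also have "\<dots> \<le> (\<Sum>X\<in>\<F>. card (?N X))" using fF by (rule card_UN_le)
  also have "\<dots> \<le> (\<Sum>X\<in>\<F>. (a choose t) * ((card M - t) choose (a - t)))"
    by (rule sum_mono, rule card_large_intersection_le) (use sub assms in auto)
  finally have le: "card M choose a \<le> card \<F> * ((a choose t) * ((card M - t) choose (a - t)))"
    by simp
  \<comment> \<open>Double counting trades \<open>card M choose a\<close> for
    \<open>card M choose t\<close>, so that the factor \<open>(card M - t) choose (a - t)\<close>
    cancels.\<close>
  have "(card M choose t) * ((card M - t) choose (a - t)) = (card M choose a) * (a choose t)"
    using choose_mult[OF assms(2,3)] by (rule sym)
  also have "\<dots> \<le> card \<F> * ((a choose t) * ((card M - t) choose (a - t))) * (a choose t)"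
    using le by (rule mult_right_mono) simp
  also have "\<dots> = (card \<F> * (a choose t) ^ 2) * ((card M - t) choose (a - t))"
    by (simp only: power2_eq_square mult_ac)
  finally have "(card M choose t) * ((card M - t) choose (a - t))
      \<le> (card \<F> * (a choose t) ^ 2) * ((card M - t) choose (a - t))" .
  moreover have "(card M - t) choose (a - t) > 0" using assms by simp
  ultimately have "card M choose t \<le> card \<F> * (a choose t) ^ 2" by simp
  with fF sub inter show thesis by (intro that[of \<F>]) auto
qed

text \<open>Dividing by \<open>fact s\<close> leaves one term of the exponential series of
  \<open>exp (real s)\<close>, which is at most \<open>3 ^ s\<close>.\<close>

lemma self_power_le_fact: "real s ^ s \<le> 3 ^ s * fact s"
proof -
  have "real s ^ s / fact s \<le> (\<Sum>n. inverse (fact n) * real s ^ n)"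
    using sum_le_suminf[OF summable_exp[of "real s"], of "{s}"]
    by (simp add: divide_inverse mult.commute)
  also have "\<dots> = exp (real s)" by (simp add: exp_def divide_inverse scaleR_conv_of_real mult.commute)
  also have "\<dots> = exp 1 ^ s" by (simp flip: exp_of_nat_mult)
  also have "\<dots> \<le> 3 ^ s" by (rule power_mono[OF exp_le]) simp
  finally show ?thesis by (simp add: field_simps)
qed

text \<open>Evaluates the size bound for \<open>a = 4 * s ^ 2\<close> and \<open>t = s\<close>:
  \<open>m choose s\<close> is at least \<open>(512 * s ^ 2) ^ s\<close>, the square of
  \<open>4 * s ^ 2 choose s\<close> is at most \<open>(144 * s ^ 2) ^ s\<close>, and
  \<open>3 * 144 \<le> 512\<close>.\<close>

lemma three_power_le_family_size:
  assumes "512 * s ^ 3 \<le> m" "m choose s \<le> N * (4 * s ^ 2 choose s) ^ 2" "s > 0"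
  shows "3 ^ s \<le> N"
proof -
  have "s ^ 1 \<le> s ^ 3" using \<open>s > 0\<close> by (intro power_increasing) auto
  then have sm: "s \<le> m" using assms(1) by simp
  have "(512 * real s ^ 2) ^ s \<le> (real m / real s) ^ s"
  proof (rule power_mono)
    have "real (512 * s ^ 3) \<le> real m" using assms(1) by (simp only: of_nat_le_iff)
    then show "512 * real s ^ 2 \<le> real m / real s"
      using assms(3) by (simp add: field_simps power3_eq_cube power2_eq_square)
  qed simp
  also have "\<dots> \<le> real (m choose s)" by (rule binomial_ge_n_over_k_pow_k[OF sm])
  also have "\<dots> \<le> real N * real (4 * s ^ 2 choose s) ^ 2"
    using assms(2) by (metis of_nat_le_iff of_nat_mult of_nat_power)
  finally have 1: "(512 * real s ^ 2) ^ s \<le> real N * real (4 * s ^ 2 choose s) ^ 2" .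
  have "real (4 * s ^ 2 choose s) * real s ^ s \<le> real (4 * s ^ 2 choose s) * (3 ^ s * fact s)"
    by (rule mult_left_mono[OF self_power_le_fact]) simp
  also have "\<dots> = 3 ^ s * real ((4 * s ^ 2 choose s) * fact s)" by simp
  also have "\<dots> \<le> 3 ^ s * real ((4 * s ^ 2) ^ s)"
    using binomial_fact_pow[of "4 * s ^ 2" s] by (intro mult_left_mono) (simp_all only: of_nat_le_iff, simp)
  also have "\<dots> = (12 * real s) ^ s * real s ^ s"
    unfolding of_nat_power power_mult_distrib[symmetric]
    by (rule arg_cong[where f = "\<lambda>x. x ^ s"]) (simp add: power2_eq_square)
  finally have "real (4 * s ^ 2 choose s) \<le> (12 * real s) ^ s"
    using assms(3) by simp
  then have "real (4 * s ^ 2 choose s) ^ 2 \<le> ((12 * real s) ^ s) ^ 2"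
    by (rule power_mono) simp
  then have "real N * real (4 * s ^ 2 choose s) ^ 2 \<le> real N * ((12 * real s) ^ s) ^ 2"
    by (rule mult_left_mono) simp
  with 1 have "(512 * real s ^ 2) ^ s \<le> real N * ((12 * real s) ^ s) ^ 2" by linarith
  also have "((12 * real s) ^ s) ^ 2 = (144 * real s ^ 2) ^ s"
  proof -
    have "((12 * real s) ^ s) ^ 2 = ((12 * real s) ^ 2) ^ s" by (metis power_mult mult.commute)
    also have "(12 * real s) ^ 2 = 144 * real s ^ 2" by (simp add: power_mult_distrib)
    finally show ?thesis .
  qed
  finally have "512 ^ s * (real s ^ 2) ^ s \<le> (real N * 144 ^ s) * (real s ^ 2) ^ s"
    by (simp add: power_mult_distrib mult_ac)
  then have "512 ^ s \<le> real N * 144 ^ s" using assms(3) by simp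
  moreover have "(3::real) ^ s * 144 ^ s \<le> 512 ^ s"
    unfolding power_mult_distrib[symmetric] by (rule power_mono) auto
  ultimately have "(3::real) ^ s * 144 ^ s \<le> real N * 144 ^ s" by linarith
  then have "real (3 ^ s) \<le> real N" by simp
  then show ?thesis by (simp only: of_nat_le_iff)
qed

section \<open>Fooling sets for blackboard protocols\<close>

primrec transcript :: "'n protocol \<Rightarrow> 'n profile \<Rightarrow> bool list" where
  "transcript (Output r) v = []"
| "transcript (Speak i b P Q) v = b (v i) # (if b (v i) then transcript P v else transcript Q v)"

lemma length_transcript: "length (transcript P v) = bits_written P v"
  by (induction P) auto

text \<open>The inputs leading to a given leaf form a combinatorial rectangle.\<close>

lemma run_mixed_profile:
  assumes "transcript P v = transcript P v'" "\<And>i. u i \<in> {v i, v' i}"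
  shows "run P u = run P v"
  using assms(1)
proof (induction P)
  case (Speak i b P Q)
  have "b (v i) = b (v' i)" using Speak.prems by simp
  moreover have "b (u i) = b (v i)" using assms(2)[of i] calculation by auto
  ultimately show ?case using Speak by (auto split: if_splits)
qed simp

text \<open>The depth of the tree bounds the number of bits, so the \<open>Max\<close> in
  \<open>protocol_cost\<close> dominates every profile whatever \<open>V\<close> is.\<close>

lemma finite_range_bits_written: "finite (range (bits_written P))"
proof -
  have "\<exists>d. \<forall>v. bits_written P v \<le> d"
  proof (induction P)
    case (Speak i b P Q)
    then obtain d e where "\<forall>v. bits_written P v \<le> d" "\<forall>v. bits_written Q v \<le> e" by blast
    then show ?case by (intro exI[of _ "Suc (max d e)"]) (auto simp: le_max_iff_disj)
  qed auto
  then obtain d where "\<forall>v. bits_written P v \<le> d" ..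
  then have "range (bits_written P) \<subseteq> {..d}" by auto
  then show ?thesis by (rule finite_subset) simp
qed

text \<open>Two inputs with the same transcript have the same outcome, and so does every mixture of
  them; \<open>fool\<close> excludes this. Hence transcripts are injective on \<open>X\<close>, and
  there are fewer than \<open>2 ^ (d + 1)\<close> bit lists of length at most
  \<open>d\<close>.\<close>

lemma card_fooling_set_less:
  fixes g :: "'x \<Rightarrow> 'n profile"
  assumes "computes V P \<A>" "g ` X \<subseteq> profiles V"
    and fool: "\<And>x y. x \<in> X \<Longrightarrow> y \<in> X \<Longrightarrow> x \<noteq> y \<Longrightarrow> \<A> (g x) = \<A> (g y) \<Longrightarrow>
      \<exists>u\<in>profiles V. (\<forall>i. u i \<in> {g x i, g y i}) \<and> \<A> u \<noteq> \<A> (g x)"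
  shows "card X < 2 ^ (Suc (protocol_cost V P))"
proof -
  let ?L = "{xs :: bool list. set xs \<subseteq> UNIV \<and> length xs \<le> protocol_cost V P}"
  have run: "run P v = \<A> v" if "v \<in> profiles V" for v
    using assms(1) that by (simp add: computes_def)
  have "inj_on (\<lambda>x. transcript P (g x)) X"
  proof (rule inj_onI, rule ccontr)
    fix x y assume xy: "x \<in> X" "y \<in> X" "transcript P (g x) = transcript P (g y)" "x \<noteq> y"
    have gX: "g x \<in> profiles V" "g y \<in> profiles V" using assms(2) xy(1,2) by auto
    have "run P (g y) = run P (g x)" by (rule run_mixed_profile[OF xy(3)]) simp
    then have "\<A> (g x) = \<A> (g y)" using run[OF gX(1)] run[OF gX(2)] by simp
    from fool[OF xy(1,2,4) this] obtain u where
      u: "u \<in> profiles V" "\<And>i. u i \<in> {g x i, g y i}" "\<A> u \<noteq> \<A> (g x)" by blast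
    show False
      using run_mixed_profile[OF xy(3) u(2)] run[OF gX(1)] run[OF u(1)] u(3) by simp
  qed
  moreover have "(\<lambda>x. transcript P (g x)) ` X \<subseteq> ?L"
  proof (clarsimp simp: length_transcript)
    fix x assume "x \<in> X"
    then have "bits_written P (g x) \<in> bits_written P ` profiles V" using assms(2) by blast
    moreover have "finite (bits_written P ` profiles V)"
      by (rule finite_subset[OF image_mono[OF subset_UNIV] finite_range_bits_written])
    ultimately show "bits_written P (g x) \<le> protocol_cost V P"
      unfolding protocol_cost_def by (intro Max_ge)
  qed
  moreover have "finite ?L" by (rule finite_lists_length_le) simp
  ultimately have "card X \<le> card ?L" by (rule card_inj_on_le)
  also have "\<dots> = (\<Sum>i\<le>protocol_cost V P. 2 ^ i)"
    using card_lists_length_le[of "UNIV :: bool set"] by simp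
  also have "\<dots> < 2 ^ (Suc (protocol_cost V P))"
  proof -
    have "(\<Sum>i\<le>n. 2 ^ i) < (2::nat) ^ Suc n" for n by (induction n) auto
    then show ?thesis .
  qed
  finally show ?thesis .
qed

section \<open>Truthful rules for two bidders\<close>

text \<open>Bidder 1 of the informal argument is the index 0 of type \<open>2\<close>, and bidder 2
  is the index 1.\<close>

definition bids :: "valuation \<Rightarrow> valuation \<Rightarrow> 2 profile" where
  "bids v1 v2 = (\<lambda>i. if i = 0 then v1 else v2)"

lemma UNIV_2_eq: "(UNIV :: 2 set) = {0, 1}"
  by (rule card_subset_eq[symmetric]) simp_all

lemma eq_1_iff_2: "i = (1 :: 2) \<longleftrightarrow> i \<noteq> 0"
  using UNIV_2_eq by auto

lemma bids_in_profiles: "v1 \<in> V \<Longrightarrow> v2 \<in> V \<Longrightarrow> bids v1 v2 \<in> profiles V"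
  by (simp add: bids_def profiles_def)

lemma welfare_2: "welfare (v :: 2 profile) S = v 0 (S 0) + v 1 (S 1)"
  by (simp add: welfare_def UNIV_2_eq)

lemma finite_allocations: "finite (allocations m :: 'n::finite allocation set)"
proof (rule finite_subset)
  show "(allocations m :: 'n allocation set) \<subseteq> UNIV \<rightarrow>\<^sub>E Pow (items m)"
    by (auto simp: allocations_def)
  show "finite ((UNIV :: 'n set) \<rightarrow>\<^sub>E Pow (items m))"
    by (rule finite_PiE) (simp_all add: items_def)
qed

lemma valuation_mono: "v \<in> valuations m \<Longrightarrow> S \<subseteq> T \<Longrightarrow> T \<subseteq> items m \<Longrightarrow> v S \<le> v T"
  using mono_onD[of "Pow (items m)" v S T] by (auto simp: valuations_def)

locale two_bidder_rule =
  fixes m :: nat and V :: "valuation set" and \<A> :: "2 rule" and \<alpha> :: real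
  assumes auction_rule: "auction_rule m V \<A>"
    and truthful: "truthful V \<A>"
    and approximation: "guarantees_approximation m V \<alpha> \<A>"
    and V_valuations: "V \<subseteq> valuations m"
    and \<alpha>_nonneg: "0 \<le> \<alpha>"
begin

definition bundle2 :: "valuation \<Rightarrow> valuation \<Rightarrow> item_bundle" where
  "bundle2 v1 v2 = bundle_of \<A> 1 (bids v1 v2)"

definition pay2 :: "valuation \<Rightarrow> valuation \<Rightarrow> real" where
  "pay2 v1 v2 = payment_of \<A> 1 (bids v1 v2)"

lemma allocation_bids:
  assumes "v1 \<in> V" "v2 \<in> V"
  shows "fst (\<A> (bids v1 v2)) \<in> allocations m"
  using funcset_mem[OF auction_rule[unfolded auction_rule_def] bids_in_profiles[OF assms]]
  by (simp add: mem_Times_iff)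

lemma bundle2_subset: "v1 \<in> V \<Longrightarrow> v2 \<in> V \<Longrightarrow> bundle2 v1 v2 \<subseteq> items m"
  using allocation_bids by (auto simp: bundle2_def bundle_of_def allocations_def)

text \<open>For fixed \<open>v1\<close> the pairs of bundle and payment form a menu, from which
  bidder 2 gets a best entry.\<close>

lemma truthful2:
  assumes "v1 \<in> V" "v2 \<in> V" "v' \<in> V"
  shows "v2 (bundle2 v1 v') - pay2 v1 v' \<le> v2 (bundle2 v1 v2) - pay2 v1 v2"
proof -
  have "(bids v1 v2)(1 := v') = bids v1 v'"
    by (auto simp: bids_def fun_eq_iff eq_1_iff_2)
  moreover have "bids v1 v2 1 = v2" by (simp add: bids_def)
  ultimately show ?thesis
    using truthful bids_in_profiles[OF assms(1,2)] assms(3)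
    unfolding truthful_def bundle2_def pay2_def by metis
qed

text \<open>Compares the outcome with one rival allocation. Bidder 1 is credited with all that
  bidder 2 leaves, so that only the bundle of bidder 2 has to be tracked.\<close>

lemma approximation2:
  assumes V: "v1 \<in> V" "v2 \<in> V" and RS: "R \<subseteq> items m" "S \<subseteq> items m" "R \<inter> S = {}"
  shows "\<alpha> * (v1 R + v2 S) \<le> v1 (items m - bundle2 v1 v2) + v2 (bundle2 v1 v2)"
proof -
  let ?v = "bids v1 v2" and ?A = "fst (\<A> (bids v1 v2))" and ?B = "(\<lambda>i. if i = 0 then R else S) :: 2 allocation"
  have "?B \<in> allocations m"
    using RS by (auto simp: allocations_def disjoint_family_on_def simp flip: eq_1_iff_2)
  then have "welfare ?v ?B \<le> Max (welfare ?v ` allocations m)"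
    by (intro Max_ge finite_imageI finite_allocations) auto
  then have "\<alpha> * welfare ?v ?B \<le> \<alpha> * Max (welfare ?v ` allocations m)"
    using \<alpha>_nonneg by (rule mult_left_mono)
  also have "\<dots> \<le> welfare ?v ?A"
    using approximation bids_in_profiles[OF V] unfolding guarantees_approximation_def by blast
  finally have 1: "\<alpha> * (v1 R + v2 S) \<le> v1 (?A 0) + v2 (bundle2 v1 v2)"
    by (simp add: welfare_2 bids_def bundle2_def bundle_of_def)
  have "?A \<in> allocations m" using allocation_bids[OF V] .
  then have "?A 0 \<subseteq> items m - bundle2 v1 v2"
    unfolding allocations_def disjoint_family_on_def bundle2_def bundle_of_def
    using zero_neq_one[where 'a = 2] by blast
  then have "v1 (?A 0) \<le> v1 (items m - bundle2 v1 v2)"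
    using V V_valuations by (intro valuation_mono[of _ m]) auto
  with 1 show ?thesis by simp
qed

end

section \<open>The hard valuations\<close>

definition overlap :: "nat set set \<Rightarrow> nat set \<Rightarrow> nat" where
  "overlap I S = Max ((\<lambda>X. card (S \<inter> X)) ` I)"

text \<open>The XOS valuation whose clauses are \<open>w\<close> times the indicator vectors of the
  members of \<open>I\<close>. The restriction makes it extensional, as \<open>valuations\<close>
  demands.\<close>

definition overlap_valuation :: "nat \<Rightarrow> nat \<Rightarrow> nat set set \<Rightarrow> valuation" where
  "overlap_valuation m w I = (\<lambda>S\<in>Pow (items m). real (w * overlap I S))"

definition single_minded_bid :: "nat \<Rightarrow> nat set \<Rightarrow> nat \<Rightarrow> valuation" where
  "single_minded_bid m T w = (\<lambda>S\<in>Pow (items m). if T \<subseteq> S then real w else 0)"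

lemma finite_items [simp]: "finite (items m)" and card_items [simp]: "card (items m) = m"
  by (simp_all add: items_def)

lemma overlap_ge: "finite I \<Longrightarrow> X \<in> I \<Longrightarrow> card (S \<inter> X) \<le> overlap I S"
  by (simp add: overlap_def)

lemma overlap_le:
  assumes "finite I" "I \<noteq> {}" "\<And>X. X \<in> I \<Longrightarrow> card (S \<inter> X) \<le> b"
  shows "overlap I S \<le> b"
  using assms by (simp add: overlap_def)

lemma overlap_mono:
  assumes "finite I" "I \<noteq> {}" "S \<subseteq> T" "finite T"
  shows "overlap I S \<le> overlap I T"
proof (rule overlap_le[OF assms(1,2)])
  fix X assume "X \<in> I"
  then have "card (T \<inter> X) \<le> overlap I T" using assms(1) by (rule overlap_ge[rotated])
  moreover have "card (S \<inter> X) \<le> card (T \<inter> X)" using assms by (intro card_mono) auto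
  ultimately show "card (S \<inter> X) \<le> overlap I T" by simp
qed

text \<open>Enough precision to place the golden ratio \<open>(sqrt 5 - 1) / 2\<close> between 3/5
  and 7/10.\<close>

lemma sqrt_5_bounds: "11 / 5 < sqrt 5" "sqrt 5 < 12 / 5"
  by (rule real_less_rsqrt, simp add: power2_eq_square)
    (rule real_less_lsqrt, simp_all add: power2_eq_square)

text \<open>Write \<open>n\<close> as \<open>n * 2 ^ k / 2 ^ k\<close>; the bound
  \<open>n \<le> 2 ^ k\<close> keeps the numerator within \<open>2 ^ (2 * k)\<close>.\<close>

lemma has_precision_nat_valued:
  assumes "\<And>S. S \<subseteq> items m \<Longrightarrow> \<exists>n\<le>2 ^ k. v S = real n"
  shows "has_precision m k v"
  unfolding has_precision_def
proof (intro allI impI)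
  fix S assume "S \<subseteq> items m"
  then obtain n where n: "n \<le> 2 ^ k" "v S = real n" using assms by blast
  show "v S \<in> {0} \<union> {real x / 2 ^ k |x. x \<in> {1..2 ^ (2 * k)}}"
  proof (cases "n = 0")
    case False
    have "n * 2 ^ k \<le> 2 ^ k * 2 ^ k" using n(1) by (rule mult_right_mono) simp
    then have "n * 2 ^ k \<in> {1..2 ^ (2 * k)}" using False by (simp add: mult_2 power_add Suc_le_eq)
    moreover have "v S = real (n * 2 ^ k) / 2 ^ k" using n(2) by simp
    ultimately show ?thesis by blast
  qed (use n in simp)
qed

lemma XOS_overlap_valuation:
  assumes "finite I" "I \<noteq> {}"
  shows "XOS m (overlap_valuation m w I)"
proof -
  let ?c = "\<lambda>X i. if i \<in> X then real w else 0"
  have "overlap_valuation m w I S = Max ((\<lambda>c. \<Sum>i\<in>S. c i) ` ?c ` I)" if S: "S \<subseteq> items m" for S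
  proof -
    have fS: "finite S" using S finite_subset[OF S] by simp
    have "overlap_valuation m w I S = real (w * Max ((\<lambda>X. card (S \<inter> X)) ` I))"
      using S by (simp add: overlap_valuation_def overlap_def)
    also have "\<dots> = Max ((\<lambda>n. real (w * n)) ` (\<lambda>X. card (S \<inter> X)) ` I)"
      using assms by (intro mono_Max_commute) (auto intro!: monoI mult_left_mono)
    also have "(\<lambda>n. real (w * n)) ` (\<lambda>X. card (S \<inter> X)) ` I = (\<lambda>c. \<Sum>i\<in>S. c i) ` ?c ` I"
      using fS by (simp add: image_image sum.If_cases Int_def mult.commute)
    finally show ?thesis .
  qed
  then show ?thesis
    unfolding XOS_def using assms by (intro exI[of _ "?c ` I"]) auto
qed

lemma overlap_valuation_mem:
  assumes "finite I" "I \<noteq> {}" "w * m \<le> 2 ^ k"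
  shows "overlap_valuation m w I \<in> XOS_or_single_minded m k"
proof -
  have "has_precision m k (overlap_valuation m w I)"
  proof (rule has_precision_nat_valued)
    fix S assume S: "S \<subseteq> items m"
    have "card (S \<inter> X) \<le> m" for X
      using card_mono[OF finite_items[of m], of "S \<inter> X"] S by auto
    then have "overlap I S \<le> m" using assms by (intro overlap_le) auto
    then have "w * overlap I S \<le> w * m" by simp
    then have "w * overlap I S \<le> 2 ^ k" using assms(3) by (rule le_trans)
    then show "\<exists>n\<le>2 ^ k. overlap_valuation m w I S = real n"
      using S by (intro exI[of _ "w * overlap I S"]) (simp add: overlap_valuation_def)
  qed
  moreover have "overlap_valuation m w I \<in> valuations m"
  proof -
    have "overlap I {} \<le> 0" using assms by (intro overlap_le) auto
    then show ?thesis
      unfolding valuations_def using assms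
      by (auto simp: overlap_valuation_def finite_subset[OF _ finite_items[of m]]
          intro!: mono_onI mult_left_mono overlap_mono)
  qed
  ultimately show ?thesis
    using XOS_overlap_valuation[OF assms(1,2)] by (simp add: XOS_or_single_minded_def)
qed

lemma single_minded_bid_mem:
  assumes "T \<subseteq> items m" "T \<noteq> {}" "w \<le> 2 ^ k"
  shows "single_minded_bid m T w \<in> XOS_or_single_minded m k"
proof -
  have "has_precision m k (single_minded_bid m T w)"
    by (rule has_precision_nat_valued)
      (use assms in \<open>auto simp: single_minded_bid_def intro: exI[of _ w] exI[of _ 0]\<close>)
  moreover have "single_minded_bid m T w \<in> valuations m"
    unfolding valuations_def using assms by (auto simp: single_minded_bid_def intro!: mono_onI split: if_splits)
  moreover have "single_minded m (single_minded_bid m T w)"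
    unfolding single_minded_def using assms
    by (intro exI[of _ "real w"] conjI exI[of _ T]) (auto simp: single_minded_bid_def)
  ultimately show ?thesis by (simp add: XOS_or_single_minded_def)
qed

section \<open>The reduction from disjointness\<close>

text \<open>The slack \<open>t / a\<close> above the golden ratio does two jobs: \<open>t\<close>
  exceeds what bidder 1 can get from a member of \<open>\<F>\<close> outside her subfamily, and
  \<open>2 \<le> t\<close> absorbs the rounding of prices to integers.
  \<open>precision_bound\<close> makes the values of \<open>val2\<close> representable.\<close>

locale hard_rule = two_bidder_rule m "XOS_or_single_minded m k" \<A> \<alpha>
  for m k :: nat and \<A> :: "2 rule" and \<alpha> :: real +
  fixes \<F> :: "nat set set" and a t :: nat
  assumes finite_family: "finite \<F>"
    and family_subset: "X \<in> \<F> \<Longrightarrow> X \<subseteq> items m"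
    and family_card: "X \<in> \<F> \<Longrightarrow> card X = a"
    and family_inter: "X \<in> \<F> \<Longrightarrow> Y \<in> \<F> \<Longrightarrow> X \<noteq> Y \<Longrightarrow> card (X \<inter> Y) < t"
    and t_bounds: "2 \<le> t" "t \<le> a" and a_less: "a < m"
    and precision_bound: "(2 * a + 1) * m \<le> 2 ^ k"
    and \<alpha>_ge: "(sqrt 5 - 1) / 2 + real t / real a \<le> \<alpha>"
begin

abbreviation V :: "valuation set" where "V \<equiv> XOS_or_single_minded m k"

definition val1 :: "nat set set \<Rightarrow> valuation" where
  "val1 I = overlap_valuation m 1 I"

text \<open>The weight makes losing one item worse than any difference of the prices that matter, so
  bidder 2 buys a full complement of a member of \<open>J\<close>.\<close>

definition val2 :: "nat set set \<Rightarrow> valuation" where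
  "val2 J = overlap_valuation m (2 * a + 1) ((\<lambda>X. items m - X) ` J)"

text \<open>Payments are not normalized, so prices are measured relative to the payment of a bidder
  without interests.\<close>

definition base_price :: "nat set set \<Rightarrow> real" where
  "base_price I = pay2 (val1 I) (single_minded_bid m (items m) 0)"

text \<open>The threshold that separates the two price levels above \<open>base_price\<close>: at
  most \<open>high - 1\<close> for complements of members of \<open>I\<close>, at least
  \<open>high\<close> for those of the other sets in \<open>\<F>\<close>. It is an integer because
  bids are.\<close>

definition high :: nat where
  "high = nat \<lfloor>(sqrt 5 - 1) / 2 * real a\<rfloor>"

section \<open>Arithmetic of the parameters and of the price threshold\<close>

lemma complement_nonempty: "X \<in> \<F> \<Longrightarrow> items m - X \<noteq> {}"
  by (metis Diff_eq_empty_iff a_less card_items card_mono family_card family_subset finite_items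
      finite_subset not_le)

lemma card_complement: "X \<in> \<F> \<Longrightarrow> card (items m - X) = m - a"
  using family_card[of X] family_subset[of X] finite_subset[of X "items m"]
  by (simp add: card_Diff_subset)

lemma a_pos: "0 < a" and a_le_precision: "2 * a \<le> 2 ^ k" and m_le_precision: "m \<le> 2 ^ k"
proof -
  show "0 < a" using t_bounds by simp
  have "(2 * a + 1) * 1 \<le> (2 * a + 1) * m" using a_less by (intro mult_left_mono) auto
  then have "2 * a + 1 \<le> 2 ^ k" using precision_bound by (metis le_trans mult.right_neutral)
  then show "2 * a \<le> 2 ^ k" by linarith
  have "1 * m \<le> (2 * a + 1) * m" by (intro mult_right_mono) auto
  then show "m \<le> 2 ^ k" using precision_bound by (metis le_trans mult_1)
qed

lemma high_bounds:
  "real high \<le> (sqrt 5 - 1) / 2 * real a" "(sqrt 5 - 1) / 2 * real a < real high + 1"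
  "1 \<le> high" "high \<le> 2 * a"
proof -
  note s = sqrt_5_bounds
  have pos: "0 \<le> (sqrt 5 - 1) / 2 * real a" using s by simp
  show 1: "real high \<le> (sqrt 5 - 1) / 2 * real a" "(sqrt 5 - 1) / 2 * real a < real high + 1"
    unfolding high_def using pos by linarith+
  have "3/5 * real a \<le> (sqrt 5 - 1) / 2 * real a" using s by (intro mult_right_mono) auto
  moreover have "2 \<le> real a" using t_bounds by simp
  ultimately have "0 < real high" using 1 by linarith
  then show "1 \<le> high" by simp
  have "(sqrt 5 - 1) / 2 * real a \<le> 1 * real a" using s by (intro mult_right_mono) auto
  then show "high \<le> 2 * a" using 1 by linarith
qed

lemma \<alpha>_high: "(sqrt 5 - 1) / 2 * real a + real t \<le> \<alpha> * real a"
proof -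
  have "((sqrt 5 - 1) / 2 + real t / real a) * real a \<le> \<alpha> * real a"
    using \<alpha>_ge by (rule mult_right_mono) simp
  then show ?thesis using a_pos by (simp add: distrib_right)
qed

text \<open>Here the golden ratio enters: \<open>\<phi> = (sqrt 5 - 1) / 2\<close> satisfies \<open>1 / \<phi> - 1 = \<phi>\<close>, so that the
  price windows for cheap and for expensive bundles touch exactly at ratio \<open>\<phi>\<close>.\<close>

lemma \<alpha>_low: "real a < \<alpha> * (real (high - 1) + real a)"
proof -
  define \<phi> where "\<phi> = (sqrt 5 - 1) / 2"
  have \<phi>: "\<phi> * \<phi> = 1 - \<phi>" by (simp add: \<phi>_def field_simps)
  have \<phi>_ge: "3/5 < \<phi>" using sqrt_5_bounds by (simp add: \<phi>_def)
  have low: "\<phi> * real a - 2 < real (high - 1)"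
    using high_bounds by (simp add: \<phi>_def of_nat_diff)
  have t: "2 \<le> real t" "real t \<le> real a" using t_bounds by auto
  \<comment> \<open>A lower bound for \<open>high - 1 + a\<close>: the floor in \<open>high\<close>
    and the subtracted one together cost less than 2.\<close>
  define y where "y = (1 + \<phi>) * real a - 2"
  have y: "y < real (high - 1) + real a" "0 < y"
  proof -
    show "y < real (high - 1) + real a" using low by (simp add: y_def algebra_simps)
    have "8 / 5 * real a \<le> (1 + \<phi>) * real a" using \<phi>_ge by (intro mult_right_mono) auto
    then show "0 < y" using t unfolding y_def by linarith
  qed
  \<comment> \<open>What is left of \<open>(\<phi> * a + t) * y - a * a\<close> once
    \<open>\<phi> * (1 + \<phi>) = 1\<close> has cancelled \<open>a * a\<close>, grouped so that
    \<open>2 \<le> t\<close> and \<open>t \<le> a\<close> give its sign.\<close>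
  have "0 \<le> (1 + \<phi>) * (real a * (real t - 2)) + 2 * (real a - real t)"
    using t \<phi>_ge by (intro add_nonneg_nonneg mult_nonneg_nonneg) auto
  also have "\<dots> = (\<phi> * real a + real t) * y - real a * real a"
  proof -
    have "\<phi> * (1 + \<phi>) = 1" using \<phi> by (simp add: algebra_simps)
    then have "\<phi> * real a * ((1 + \<phi>) * real a) = real a * real a" 
      by (metis mult.assoc mult.left_commute mult_1)
    then show ?thesis by (simp add: y_def algebra_simps)
  qed
  finally have "real a * real a \<le> (\<phi> * real a + real t) * y" by simp
  also have "\<dots> \<le> (\<alpha> * real a) * y"
    using \<alpha>_high y by (intro mult_right_mono) (auto simp: \<phi>_def)
  also have "\<dots> < (\<alpha> * real a) * (real (high - 1) + real a)"
  proof (rule mult_strict_left_mono[OF y(1)])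
    have "0 < \<phi> * real a" using \<phi>_ge a_pos by simp
    then show "0 < \<alpha> * real a" using \<alpha>_high t unfolding \<phi>_def by linarith
  qed
  finally show ?thesis using a_pos by (simp add: mult_ac)
qed

text \<open>Above ratio 1/2 a single-minded bid of \<open>2 * a\<close> wins any complement against
  \<open>val1 I\<close>, whose values are at most \<open>a\<close>. This caps the relevant
  prices.\<close>

lemma \<alpha>_gt_half: "1 / 2 < \<alpha>"
proof -
  have "1 / 2 < (sqrt 5 - 1) / 2" using sqrt_5_bounds(1) by simp
  moreover have "0 \<le> real t / real a" by simp
  ultimately show ?thesis using \<alpha>_ge by linarith
qed

section \<open>Membership and extreme values of the hard valuations\<close>

lemma val1_mem: "I \<subseteq> \<F> \<Longrightarrow> I \<noteq> {} \<Longrightarrow> val1 I \<in> V"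
  unfolding val1_def using m_le_precision finite_subset[OF _ finite_family]
  by (intro overlap_valuation_mem) simp_all

lemma val2_mem: "J \<subseteq> \<F> \<Longrightarrow> J \<noteq> {} \<Longrightarrow> val2 J \<in> V"
  unfolding val2_def using precision_bound finite_subset[OF _ finite_family]
  by (intro overlap_valuation_mem) simp_all

lemma sm_mem: "X \<in> \<F> \<Longrightarrow> w \<le> 2 * a \<Longrightarrow> single_minded_bid m (items m - X) w \<in> V"
  using complement_nonempty a_le_precision by (intro single_minded_bid_mem) simp_all

lemma zero_mem: "single_minded_bid m (items m) 0 \<in> V"
  using a_less by (intro single_minded_bid_mem) (simp_all add: items_def)

lemma val1_le: "I \<subseteq> \<F> \<Longrightarrow> I \<noteq> {} \<Longrightarrow> S \<subseteq> items m \<Longrightarrow> val1 I S \<le> real a"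
proof -
  assume I: "I \<subseteq> \<F>" "I \<noteq> {}" and S: "S \<subseteq> items m"
  have "overlap I S \<le> a"
  proof (rule overlap_le)
    fix X assume "X \<in> I"
    then have "X \<in> \<F>" using I by blast
    then show "card (S \<inter> X) \<le> a"
      using family_card[of X] family_subset[of X] card_mono[of X "S \<inter> X"] finite_subset[of X "items m"] by auto
  qed (use I finite_family finite_subset in auto)
  then show ?thesis using S by (simp add: val1_def overlap_valuation_def)
qed

lemma val1_member_ge:
  assumes "I \<subseteq> \<F>" "X \<in> I" "X \<subseteq> S" "S \<subseteq> items m"
  shows "real a \<le> val1 I S"
proof -
  have "S \<inter> X = X" using assms by blast
  then have "a \<le> overlap I S"
    using overlap_ge[of I X S] finite_subset[OF assms(1) finite_family] family_card[of X] assms by auto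
  then show ?thesis using assms by (simp add: val1_def overlap_valuation_def)
qed

lemma val1_nonmember_less:
  assumes "I \<subseteq> \<F>" "I \<noteq> {}" "X \<in> \<F> - I"
  shows "val1 I X < real t"
proof -
  have "overlap I X \<le> t - 1"
  proof (rule overlap_le)
    fix Y assume "Y \<in> I"
    then show "card (X \<inter> Y) \<le> t - 1"
      using family_inter[of X Y] assms by fastforce
  qed (use assms finite_subset[OF assms(1) finite_family] in auto)
  then show ?thesis
    using t_bounds family_subset[of X] assms by (simp add: val1_def overlap_valuation_def)
qed

lemma val2_le:
  assumes "J \<subseteq> \<F>" "J \<noteq> {}" "S \<subseteq> items m"
  shows "val2 J S \<le> real ((2 * a + 1) * (m - a))"
proof -
  have "overlap ((\<lambda>X. items m - X) ` J) S \<le> m - a"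
  proof (rule overlap_le)
    fix Y assume "Y \<in> (\<lambda>X. items m - X) ` J"
    then obtain X where X: "X \<in> \<F>" "Y = items m - X" using assms by blast
    then show "card (S \<inter> Y) \<le> m - a"
      using card_complement[of X] card_mono[of Y "S \<inter> Y"] by simp
  qed (use assms finite_subset[OF assms(1) finite_family] in auto)
  then show ?thesis
    using assms(3) by (simp only: val2_def overlap_valuation_def) (simp only: restrict_apply' Pow_iff of_nat_le_iff mult_le_mono2)
qed

text \<open>A bundle without a full complement misses an item of each one, so it loses at least one
  weight \<open>2 * a + 1\<close> against the maximum.\<close>

lemma val2_not_full_le:
  assumes "J \<subseteq> \<F>" "J \<noteq> {}" "S \<subseteq> items m" "\<And>X. X \<in> J \<Longrightarrow> \<not> items m - X \<subseteq> S"
  shows "val2 J S \<le> real ((2 * a + 1) * (m - a - 1))"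
proof -
  have "overlap ((\<lambda>X. items m - X) ` J) S \<le> m - a - 1"
  proof (rule overlap_le)
    fix Y assume "Y \<in> (\<lambda>X. items m - X) ` J"
    then obtain X where X: "X \<in> \<F>" "X \<in> J" "Y = items m - X" using assms by blast
    then have "S \<inter> Y \<subset> Y" using assms(4) by blast
    then have "card (S \<inter> Y) < card Y" using X by (intro psubset_card_mono) auto
    then show "card (S \<inter> Y) \<le> m - a - 1"
      using card_complement[of X] X by simp
  qed (use assms finite_subset[OF assms(1) finite_family] in auto)
  then show ?thesis
    using assms(3) by (simp only: val2_def overlap_valuation_def) (simp only: restrict_apply' Pow_iff of_nat_le_iff mult_le_mono2)
qed

lemma val2_full_ge:
  assumes "J \<subseteq> \<F>" "X \<in> J" "S \<subseteq> items m" "items m - X \<subseteq> S"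
  shows "real ((2 * a + 1) * (m - a)) \<le> val2 J S"
proof -
  have "S \<inter> (items m - X) = items m - X" using assms by blast
  then have "m - a \<le> overlap ((\<lambda>X. items m - X) ` J) S"
    using overlap_ge[of "(\<lambda>X. items m - X) ` J" "items m - X" S] card_complement[of X] assms
      finite_subset[OF assms(1) finite_family] by auto
  then show ?thesis
    using assms(3) by (simp only: val2_def overlap_valuation_def) (simp only: restrict_apply' Pow_iff of_nat_le_iff mult_le_mono2)
qed

section \<open>Prices forced by truthfulness and approximation\<close>

lemma base_price_le:
  assumes I: "I \<subseteq> \<F>" "I \<noteq> {}" and "v2 \<in> V"
  shows "base_price I \<le> pay2 (val1 I) v2"
proof -
  have "single_minded_bid m (items m) 0 S = 0" if "S \<subseteq> items m" for S
    using that by (simp add: single_minded_bid_def)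
  \<comment> \<open>A bidder who values nothing gains only by paying less, so her payment is the
    least on the menu.\<close>
  with truthful2[OF val1_mem[OF I] zero_mem assms(3)] show ?thesis
    using bundle2_subset[OF val1_mem[OF I] zero_mem] bundle2_subset[OF val1_mem[OF I] assms(3)]
    by (simp add: base_price_def)
qed

text \<open>If the bid lost, the welfare would be at most \<open>a\<close>, less than
  \<open>\<alpha>\<close> times the welfare of giving \<open>X\<close> to bidder 1 and the rest to
  bidder 2. As a winner she must not envy the bidder without interests, which caps her
  payment.\<close>

lemma complement_affordable:
  assumes I: "I \<subseteq> \<F>" "I \<noteq> {}" and X: "X \<in> \<F>" and w: "w \<le> 2 * a"
    and win: "real a < \<alpha> * (val1 I X + real w)"
  defines "s \<equiv> single_minded_bid m (items m - X) w"
  shows "items m - X \<subseteq> bundle2 (val1 I) s" "pay2 (val1 I) s \<le> base_price I + real w"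
proof -
  note I' = val1_mem[OF I]
  have s: "s \<in> V" unfolding s_def by (rule sm_mem[OF X w])
  note B = bundle2_subset[OF I' s]
  have "\<alpha> * (val1 I X + s (items m - X))
      \<le> val1 I (items m - bundle2 (val1 I) s) + s (bundle2 (val1 I) s)"
    using family_subset[OF X] by (intro approximation2[OF I' s]) auto
  moreover have "s (items m - X) = real w" by (simp add: s_def single_minded_bid_def)
  moreover have "val1 I (items m - bundle2 (val1 I) s) \<le> real a" by (rule val1_le[OF I]) auto
  ultimately have "0 < s (bundle2 (val1 I) s)" using win by simp
  then show "items m - X \<subseteq> bundle2 (val1 I) s"
    using B by (auto simp: s_def single_minded_bid_def split: if_splits)
  then have "s (bundle2 (val1 I) s) = real w" using B by (simp add: s_def single_minded_bid_def)
  moreover have "0 \<le> s (bundle2 (val1 I) (single_minded_bid m (items m) 0))"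
    using bundle2_subset[OF I' zero_mem] by (simp add: s_def single_minded_bid_def)
  ultimately show "pay2 (val1 I) s \<le> base_price I + real w"
    using truthful2[OF I' s zero_mem] by (simp add: base_price_def)
qed

text \<open>A bid of \<open>high\<close> for this complement must lose. A loser has utility at most
  \<open>- base_price I\<close>, and could report \<open>v2\<close> to obtain the complement;
  truthfulness then makes it cost at least \<open>high\<close> above the base.\<close>

lemma complement_expensive:
  assumes I: "I \<subseteq> \<F>" "I \<noteq> {}" and X: "X \<in> \<F> - I" and v2: "v2 \<in> V"
    and sub: "items m - X \<subseteq> bundle2 (val1 I) v2"
  shows "base_price I + real high \<le> pay2 (val1 I) v2"
proof -
  define s where "s = single_minded_bid m (items m - X) high"
  note I' = val1_mem[OF I]
  have s: "s \<in> V" unfolding s_def using X high_bounds by (intro sm_mem) auto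
  note B = bundle2_subset[OF I' s]
  have lose: "\<not> items m - X \<subseteq> bundle2 (val1 I) s"
  proof
    assume *: "items m - X \<subseteq> bundle2 (val1 I) s"
    \<comment> \<open>The rival allocation gives everything to bidder 1 and is worth at least
      \<open>a\<close>, whereas a win of bidder 2 yields less than \<open>t + high\<close>.\<close>
    have "\<alpha> * (val1 I (items m) + s {})
        \<le> val1 I (items m - bundle2 (val1 I) s) + s (bundle2 (val1 I) s)"
      by (intro approximation2[OF I' s]) auto
    moreover have "s {} = 0" using complement_nonempty[of X] X by (simp add: s_def single_minded_bid_def)
    moreover have "val1 I (items m - bundle2 (val1 I) s) \<le> val1 I X"
      using * I' V_valuations family_subset[of X] X by (intro valuation_mono[of _ m]) auto
    moreover have "val1 I X < real t" by (rule val1_nonmember_less[OF I X])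
    moreover have "s (bundle2 (val1 I) s) = real high"
      using * B by (simp add: s_def single_minded_bid_def)
    moreover have "real a \<le> val1 I (items m)"
      using I family_subset by (auto intro!: val1_member_ge)
    then have "\<alpha> * real a \<le> \<alpha> * val1 I (items m)"
      using \<alpha>_nonneg by (rule mult_left_mono)
    ultimately show False using \<alpha>_high high_bounds(1) by simp
  qed
  have "s (bundle2 (val1 I) v2) - pay2 (val1 I) v2 \<le> s (bundle2 (val1 I) s) - pay2 (val1 I) s"
    by (rule truthful2[OF I' s v2])
  moreover have "s (bundle2 (val1 I) v2) = real high"
    using sub bundle2_subset[OF I' v2] by (simp add: s_def single_minded_bid_def)
  moreover have "s (bundle2 (val1 I) s) = 0"
    using lose B by (simp add: s_def single_minded_bid_def)
  ultimately show ?thesis using base_price_le[OF I s] by simp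
qed

text \<open>The complement of a common member sells for at most \<open>high - 1\<close> above the
  base and already gives \<open>val2 J\<close> its maximum, so bidder 2 never pays more than
  that.\<close>

lemma pay2_intersecting:
  assumes I: "I \<subseteq> \<F>" and J: "J \<subseteq> \<F>" and X: "X \<in> I \<inter> J"
  shows "pay2 (val1 I) (val2 J) \<le> base_price I + real (high - 1)"
proof -
  have ne: "I \<noteq> {}" "J \<noteq> {}" and XF: "X \<in> \<F>" using assms by blast+
  define s where "s = single_minded_bid m (items m - X) (high - 1)"
  have "real a \<le> val1 I X" using val1_member_ge[of I X X] I X family_subset[OF XF] by auto
  then have "\<alpha> * (real (high - 1) + real a) \<le> \<alpha> * (val1 I X + real (high - 1))"
    using \<alpha>_nonneg by (intro mult_left_mono) auto
  then have "real a < \<alpha> * (val1 I X + real (high - 1))" using \<alpha>_low by simp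
  then have aff: "items m - X \<subseteq> bundle2 (val1 I) s" "pay2 (val1 I) s \<le> base_price I + real (high - 1)"
    unfolding s_def using complement_affordable[OF I ne(1) XF, of "high - 1"] high_bounds by auto
  note I' = val1_mem[OF I ne(1)] and J' = val2_mem[OF J ne(2)]
  have s: "s \<in> V" unfolding s_def using high_bounds by (intro sm_mem[OF XF]) auto
  have "val2 J (bundle2 (val1 I) s) - pay2 (val1 I) s
      \<le> val2 J (bundle2 (val1 I) (val2 J)) - pay2 (val1 I) (val2 J)"
    by (rule truthful2[OF I' J' s])
  moreover have "real ((2 * a + 1) * (m - a)) \<le> val2 J (bundle2 (val1 I) s)"
    using X bundle2_subset[OF I' s] aff(1) by (intro val2_full_ge[OF J]) auto
  moreover have "val2 J (bundle2 (val1 I) (val2 J)) \<le> real ((2 * a + 1) * (m - a))"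
    by (rule val2_le[OF J ne(2) bundle2_subset[OF I' J']])
  ultimately show ?thesis using aff(2) by linarith
qed

text \<open>Bidder 2 must receive the full complement of some member of \<open>J\<close>; that
  member lies outside \<open>I\<close>, so its complement is expensive.\<close>

lemma pay2_disjoint:
  assumes I: "I \<subseteq> \<F>" "I \<noteq> {}" and J: "J \<subseteq> \<F>" "J \<noteq> {}" and disj: "I \<inter> J = {}"
  shows "base_price I + real high \<le> pay2 (val1 I) (val2 J)"
proof -
  obtain Y where Y: "Y \<in> J" "Y \<in> \<F>" using J by blast
  define s where "s = single_minded_bid m (items m - Y) (2 * a)"
  note I' = val1_mem[OF I] and J' = val2_mem[OF J]
  have s: "s \<in> V" unfolding s_def by (intro sm_mem[OF Y(2)]) auto
  have "0 \<le> val1 I Y" using family_subset[OF Y(2)] by (simp add: val1_def overlap_valuation_def)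
  then have "\<alpha> * real (2 * a) \<le> \<alpha> * (val1 I Y + real (2 * a))"
    using \<alpha>_nonneg by (intro mult_left_mono) auto
  moreover have "1 / 2 * real (2 * a) < \<alpha> * real (2 * a)"
    using \<alpha>_gt_half a_pos by (intro mult_strict_right_mono) auto
  ultimately have "real a < \<alpha> * (val1 I Y + real (2 * a))" by simp
  then have aff: "items m - Y \<subseteq> bundle2 (val1 I) s" "pay2 (val1 I) s \<le> base_price I + real (2 * a)"
    unfolding s_def using complement_affordable[OF I Y(2), of "2 * a"] by auto
  have "\<exists>X\<in>J. items m - X \<subseteq> bundle2 (val1 I) (val2 J)"
  proof (rule ccontr)
    assume "\<not> ?thesis"
    then have "val2 J (bundle2 (val1 I) (val2 J)) \<le> real ((2 * a + 1) * (m - a - 1))"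
      by (intro val2_not_full_le[OF J bundle2_subset[OF I' J']]) auto
    moreover have "val2 J (bundle2 (val1 I) s) - pay2 (val1 I) s
        \<le> val2 J (bundle2 (val1 I) (val2 J)) - pay2 (val1 I) (val2 J)"
      by (rule truthful2[OF I' J' s])
    moreover have "real ((2 * a + 1) * (m - a)) \<le> val2 J (bundle2 (val1 I) s)"
      using Y(1) bundle2_subset[OF I' s] aff(1) by (intro val2_full_ge[OF J(1)]) auto
    moreover have "base_price I \<le> pay2 (val1 I) (val2 J)" by (rule base_price_le[OF I J'])
    \<comment> \<open>Settling for less loses \<open>2 * a + 1\<close> in value but saves at most
      \<open>2 * a\<close> in payment; the extra one makes the contradiction strict.\<close>
    moreover have "real ((2 * a + 1) * (m - a)) = real ((2 * a + 1) * (m - a - 1)) + real (2 * a) + 1"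
    proof -
      have "m - a = Suc (m - a - 1)" using a_less by simp
      then have "(2 * a + 1) * (m - a) = (2 * a + 1) + (2 * a + 1) * (m - a - 1)"
        by (metis mult_Suc_right)
      then show ?thesis by (simp only: of_nat_add)
    qed
    ultimately show False using aff(2) by linarith
  qed
  then obtain X where X: "X \<in> J" "items m - X \<subseteq> bundle2 (val1 I) (val2 J)" by (rule bexE)
  have "X \<in> \<F> - I" using X(1) J(1) disj by (metis DiffI IntI empty_iff subsetD)
  then show ?thesis using J' X(2) by (rule complement_expensive[OF I])
qed

section \<open>A fooling set of complementary subfamilies\<close>

lemma family_card_le_cost:
  assumes "computes V P \<A>" "2 \<le> card \<F>"
  shows "card \<F> \<le> protocol_cost V P + 1"
proof -
  \<comment> \<open>The two extreme subfamilies are left out, since both \<open>I\<close> and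
    \<open>\<F> - I\<close> must supply at least one clause.\<close>
  let ?X = "Pow \<F> - {{}, \<F>}"
  define g where "g I = bids (val1 I) (val2 (\<F> - I))" for I
  have X: "I \<subseteq> \<F>" "I \<noteq> {}" "\<F> - I \<subseteq> \<F>" "\<F> - I \<noteq> {}" if "I \<in> ?X" for I
  proof -
    show "I \<subseteq> \<F>" "I \<noteq> {}" "\<F> - I \<subseteq> \<F>" using that by simp_all
    have "I \<noteq> \<F>" using that by simp
    then show "\<F> - I \<noteq> {}" using \<open>I \<subseteq> \<F>\<close> by (metis Diff_eq_empty_iff subset_antisym)
  qed
  have bids: "bids (val1 I) (val2 (\<F> - I')) \<in> profiles V" if "I \<in> ?X" "I' \<in> ?X" for I I'
    by (rule bids_in_profiles[OF val1_mem[OF X(1,2)[OF that(1)]] val2_mem[OF X(3,4)[OF that(2)]]])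
  have "card ?X < 2 ^ (Suc (protocol_cost V P))"
  proof (rule card_fooling_set_less[OF assms(1), of g])
    show "g ` ?X \<subseteq> profiles V"
      unfolding g_def using bids by blast
  next
    \<comment> \<open>A \<open>Z\<close> in \<open>I - I'\<close> is common to \<open>I\<close> and
      \<open>\<F> - I'\<close>, so the mixed payment is low while that of \<open>g I\<close> is
      high. Both refer to the same \<open>base_price I\<close>, whose value is therefore
      irrelevant.\<close>
    have mixed: "\<A> (bids (val1 I) (val2 (\<F> - I'))) \<noteq> \<A> (g I)"
      if "I \<in> ?X" "I' \<in> ?X" "Z \<in> I - I'" for I I' Z
    proof
      assume eq: "\<A> (bids (val1 I) (val2 (\<F> - I'))) = \<A> (g I)"
      have "base_price I + real high \<le> pay2 (val1 I) (val2 (\<F> - I))"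
        by (rule pay2_disjoint[OF X[OF that(1)]]) blast
      also have "\<dots> = pay2 (val1 I) (val2 (\<F> - I'))"
        using eq by (simp add: pay2_def payment_of_def g_def)
      also have "\<dots> \<le> base_price I + real (high - 1)"
        using that by (intro pay2_intersecting[OF X(1)[OF that(1)] X(3)[OF that(2)], of Z]) blast
      finally show False using high_bounds(3) by simp
    qed
    fix I I' assume I: "I \<in> ?X" "I' \<in> ?X" "I \<noteq> I'" and eq: "\<A> (g I) = \<A> (g I')"
    \<comment> \<open>The difference of \<open>I\<close> and \<open>I'\<close> may lie on either
      side, which decides which of the two mixed profiles is the witness.\<close>
    consider Z where "Z \<in> I - I'" | Z where "Z \<in> I' - I" using I(3) by blast
    then show "\<exists>u\<in>profiles V. (\<forall>i. u i \<in> {g I i, g I' i}) \<and> \<A> u \<noteq> \<A> (g I)"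
    proof cases
      case 1
      show ?thesis
      proof (intro bexI conjI)
        show "\<A> (bids (val1 I) (val2 (\<F> - I'))) \<noteq> \<A> (g I)" using mixed I 1 by blast
        show "bids (val1 I) (val2 (\<F> - I')) \<in> profiles V" by (rule bids; fact I)
      qed (simp add: g_def bids_def)
    next
      case 2
      show ?thesis
      proof (intro bexI conjI)
        show "\<A> (bids (val1 I') (val2 (\<F> - I))) \<noteq> \<A> (g I)" unfolding eq using mixed I 2 by blast
        show "bids (val1 I') (val2 (\<F> - I)) \<in> profiles V" by (rule bids; fact I)
      qed (simp add: g_def bids_def)
    qed
  qed
  moreover have "card ?X = 2 ^ card \<F> - card {{}, \<F>}"
    using finite_family by (subst card_Diff_subset) (auto simp: card_Pow)
  moreover have "card {{}, \<F>} \<le> 2" by (simp add: card_insert_if)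
  ultimately have less: "2 ^ card \<F> < 2 ^ (Suc (protocol_cost V P)) + (2::nat)" by linarith
  show ?thesis
  proof (rule ccontr)
    assume "\<not> ?thesis"
    then have "(2::nat) ^ (Suc (Suc (protocol_cost V P))) \<le> 2 ^ card \<F>"
      by (intro power_increasing) auto
    moreover have "(1::nat) \<le> 2 ^ protocol_cost V P" by simp
    ultimately show False using less unfolding power_Suc by linarith
  qed
qed

end

section \<open>The communication lower bound\<close>

text \<open>Shows that precision \<open>m\<close> suffices for the hard valuations, whose values are
  at most \<open>m * m\<close>.\<close>

lemma square_le_two_power: "n * n \<le> 2 ^ n" if "4 \<le> n" for n :: nat
  using that
proof (induction n rule: dec_induct)
  case (step n)
  have "4 * n \<le> n * n" using step.hyps by (intro mult_right_mono) auto
  then have "2 * n + 1 \<le> n * n" using step.hyps by linarith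
  then have "Suc n * Suc n \<le> 2 * (n * n)" by simp
  also have "\<dots> \<le> 2 * 2 ^ n" using step.IH by simp
  finally show ?case by simp
qed simp

lemma ex_cube_scale:
  assumes "13824 \<le> m"
  obtains s :: nat where "3 \<le> s" "512 * s ^ 3 \<le> m" "real m powr (1 / 3) \<le> 12 * real s"
proof -
  define r where "r = real m powr (1 / 3)"
  \<comment> \<open>Dividing by 8 gives \<open>512 = 8 ^ 3\<close> in the size condition, and
    \<open>13824 = 24 ^ 3\<close> ensures \<open>3 \<le> s\<close>, so that
    \<open>8 * s + 8 \<le> 12 * s\<close>.\<close>
  define s where "s = nat \<lfloor>r / 8\<rfloor>"
  have r3: "r ^ 3 = real m" and r0: "0 \<le> r"
    using assms by (simp_all add: r_def powr_powr flip: powr_numeral)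
  have "24 \<le> r"
  proof (rule ccontr)
    assume "\<not> 24 \<le> r"
    then have "r ^ 3 < 24 ^ 3" using r0 by (intro power_strict_mono) auto
    then show False using r3 assms by simp
  qed
  then have s: "3 \<le> s" "8 * real s \<le> r" "r < 8 * real s + 8"
    unfolding s_def by linarith+
  have "(8 * real s) ^ 3 \<le> real m" unfolding r3[symmetric] using s(2) by (intro power_mono) auto
  then have "real (512 * s ^ 3) \<le> real m" by (simp add: power_mult_distrib)
  then have "512 * s ^ 3 \<le> m" by (simp only: of_nat_le_iff)
  moreover have "r \<le> 12 * real s" using s by simp
  ultimately show thesis using that s(1) by (simp add: r_def)
qed

theorem theorem5p1:
  "\<exists>(c::real) (m0::nat) (k::nat \<Rightarrow> nat).
     c > 0 \<and>
     (\<exists>d::nat. (\<lambda>m. real (k m)) \<in> O(\<lambda>m. real m ^ d)) \<and>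
     (\<forall>m\<ge>m0. \<forall>\<A> :: 2 rule.
        auction_rule m (XOS_or_single_minded m (k m)) \<A> \<longrightarrow>
        truthful (XOS_or_single_minded m (k m)) \<A> \<longrightarrow>
        guarantees_approximation m (XOS_or_single_minded m (k m))
          ((sqrt 5 - 1) / 2 + 3 * real m powr (- (1 / 3))) \<A> \<longrightarrow>
        ereal_of_enat (cc (XOS_or_single_minded m (k m)) \<A>)
          \<ge> ereal (exp (c * real m powr (1 / 3))))"
proof (rule exI[of _ "1 / 24"], rule exI[of _ 13824], rule exI[of _ "\<lambda>m. m"],
    intro conjI allI impI)
  show "\<exists>d. (\<lambda>m. real m) \<in> O(\<lambda>m. real m ^ d)" by (rule exI[of _ 1]) simp
next
  fix m :: nat and \<A> :: "2 rule"
  assume m: "13824 \<le> m" and rule: "auction_rule m (XOS_or_single_minded m m) \<A>"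
    "truthful (XOS_or_single_minded m m) \<A>"
    "guarantees_approximation m (XOS_or_single_minded m m)
       ((sqrt 5 - 1) / 2 + 3 * real m powr (- (1 / 3))) \<A>"
  obtain s where s: "3 \<le> s" "512 * s ^ 3 \<le> m" "real m powr (1 / 3) \<le> 12 * real s"
    using ex_cube_scale[OF m] by blast
  \<comment> \<open>With \<open>t = s\<close> the ratio \<open>t / a\<close> is of order
    \<open>m powr (- 1 / 3)\<close>, while the family still has at least \<open>3 ^ s\<close>
    members.\<close>
  define a where "a = 4 * s ^ 2"
  have "s ^ 2 \<le> s ^ 3" using s(1) by (intro power_increasing) auto
  moreover have "1 \<le> s ^ 2" "s \<le> s ^ 2" using s(1) by (auto simp: power2_eq_square)
  ultimately have a: "2 * a + 1 \<le> m" "s \<le> a" using s(2) by (auto simp: a_def)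
  obtain \<F> where \<F>: "finite \<F>" "\<And>X. X \<in> \<F> \<Longrightarrow> X \<subseteq> items m \<and> card X = a"
    "\<And>X Y. X \<in> \<F> \<Longrightarrow> Y \<in> \<F> \<Longrightarrow> X \<noteq> Y \<Longrightarrow> card (X \<inter> Y) < s"
    "m choose s \<le> card \<F> * (a choose s) ^ 2"
    using ex_family_small_intersections[of "items m" s a] a by auto
  interpret hard_rule m m \<A> "(sqrt 5 - 1) / 2 + 3 * real m powr (- (1 / 3))" \<F> a s
  proof
    show "XOS_or_single_minded m m \<subseteq> valuations m" by (auto simp: XOS_or_single_minded_def)
    have "1 \<le> sqrt 5" by simp
    then show "0 \<le> (sqrt 5 - 1) / 2 + 3 * real m powr (- (1 / 3))" by simp
    have "(2 * a + 1) * m \<le> m * m" using a(1) by (rule mult_right_mono) simp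
    also have "\<dots> \<le> 2 ^ m" using m by (intro square_le_two_power) simp
    finally show "(2 * a + 1) * m \<le> 2 ^ m" .
    \<comment> \<open>The factor 3 in the approximation ratio arises here, from
      \<open>1 / (4 * s) = 3 / (12 * s)\<close> and
      \<open>m powr (1 / 3) \<le> 12 * s\<close>.\<close>
    have "real s / real a = 1 / (4 * real s)" using s(1) by (simp add: a_def power2_eq_square)
    also have "\<dots> = 3 / (12 * real s)" by simp
    also have "\<dots> \<le> 3 / real m powr (1 / 3)" using s(1,3) m by (intro divide_left_mono) auto
    finally show "(sqrt 5 - 1) / 2 + real s / real a \<le> (sqrt 5 - 1) / 2 + 3 * real m powr (- (1 / 3))"
      by (simp add: powr_minus_divide)
  qed (use rule \<F> s a in auto)
  have F3: "3 ^ s \<le> card \<F>"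
    using three_power_le_family_size[OF s(2) \<F>(4)[unfolded a_def]] s(1) by simp
  have "(3::nat) ^ 1 \<le> 3 ^ s" using s(1) by (intro power_increasing) auto
  then have "enat (3 ^ s - 1) \<le> cc V \<A>"
    unfolding cc_def using family_card_le_cost F3 by (intro INF_greatest) force
  then have "ereal (real (3 ^ s - 1)) \<le> ereal_of_enat (cc V \<A>)"
    by (metis ereal_of_enat_le_iff ereal_of_enat_simps(1))
  moreover have "exp (1 / 24 * real m powr (1 / 3)) \<le> real (3 ^ s - 1)"
  proof -
    \<comment> \<open>The constant 1/24 turns \<open>12 * s\<close> into \<open>s / 2\<close>;
      passing from \<open>2 ^ s\<close> to \<open>3 ^ s\<close> absorbs the one lost between family
      size and cost.\<close>
    have "exp (1 / 24 * real m powr (1 / 3)) \<le> exp (real s * (1 / 2))" using s(3) by simp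
    also have "\<dots> = exp (1 / 2) ^ s" by (rule exp_of_nat_mult)
    also have "\<dots> \<le> 2 ^ s" by (intro power_mono exp_half_le2) simp
    also have "\<dots> \<le> real (3 ^ s - 1)"
    proof -
      have "(2::nat) ^ s < 3 ^ s" using s(1) by (intro power_strict_mono) auto
      then have "(2::nat) ^ s \<le> 3 ^ s - 1" by linarith
      then have "real (2 ^ s) \<le> real (3 ^ s - 1)" by (simp only: of_nat_le_iff)
      then show ?thesis by simp
    qed
    finally show ?thesis .
  qed
  ultimately show "ereal_of_enat (cc V \<A>) \<ge> ereal (exp (1 / 24 * real m powr (1 / 3)))"
    by (meson ereal_less_eq(3) order_trans)
qed simp

end
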